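(* Let $\lambda_1,\lambda_2\ge 0$, $c\in\mathbb{R}$, and let $\alpha_1,\alpha_2,\beta_1,\beta_2\ge 2$ be even integers. Then the polynomial $$p(x_1,x_2)=\lambda_1\lambda_2\big(x_1^{2\alpha_1}x_2^{2\beta_1}+x_1^{2\alpha_2}x_2^{2\beta_2}\big)+(\lambda_1^2+\lambda_2^2-c)\,x_1^{\alpha_1+\alpha_2}x_2^{\beta_1+\beta_2}$$ is non-convex, i.e. it is not a convex function on $\mathbb{R}^2$.
   Context: These polynomials are the two-variable members of the AHI family $\sum_{i<j}\lambda_i\lambda_j(x^{2\alpha(i)}+x^{2\alpha(j)})\prod_{k\neq i,j}x^{\alpha(k)}+(\sum_i\lambda_i^2-c)\prod_i x^{\alpha(i)}$ built from the general squared monomials $x^{\alpha(1)}=x_1^{\alpha_1}x_2^{\beta_1}$ and $x^{\alpha(2)}=x_1^{\alpha_2}x_2^{\beta_2}$. A polynomial is convex if and only if its Hessian is positive semidefinite at every point.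
   Formalization: The formal theorem additionally assumes that p is not identically zero; without this the claim is false, e.g. λ1 = λ2 = c = 0 gives p = 0, which is convex. *)

theory Defs
  imports "HOL-Analysis.Analysis"
begin

text \<open>Two-variable AHI polynomial on \<open>\<real>\<^sup>2\<close>, with \<open>l1\<close>, \<open>l2\<close> for \<open>\<lambda>\<^sub>1\<close>, \<open>\<lambda>\<^sub>2\<close>.
  All coefficients can vanish (e.g. \<open>l1 = 1\<close>, \<open>l2 = 0\<close>, \<open>c = 1\<close>, or \<open>\<alpha>1 = \<alpha>2\<close>, \<open>\<beta>1 = \<beta>2\<close>,
  \<open>c = (l1 + l2)\<^sup>2\<close>); the result is then the zero polynomial, which is convex, so non-convexity
  can only be claimed when the polynomial is nonzero.\<close>

definition ahi2 :: "real \<Rightarrow> real \<Rightarrow> real \<Rightarrow> nat \<Rightarrow> nat \<Rightarrow> nat \<Rightarrow> nat \<Rightarrow> real ^ 2 \<Rightarrow> real" where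
  "ahi2 l1 l2 c \<alpha>1 \<alpha>2 \<beta>1 \<beta>2 x =
     l1 * l2 * ((x $ 1) ^ (2 * \<alpha>1) * (x $ 2) ^ (2 * \<beta>1) + (x $ 1) ^ (2 * \<alpha>2) * (x $ 2) ^ (2 * \<beta>2))
     + (l1\<^sup>2 + l2\<^sup>2 - c) * ((x $ 1) ^ (\<alpha>1 + \<alpha>2) * (x $ 2) ^ (\<beta>1 + \<beta>2))"

end

theory Submission
  imports Defs
begin

text \<open>The polynomial vanishes on both coordinate axes, because each of its monomials contains both
  variables. Every point \<open>(a, b)\<close> of the plane is the midpoint of the axis points \<open>(2a, 0)\<close>
  and \<open>(0, 2b)\<close>, so convexity together with vanishing on the axes forces the values to be
  nonpositive everywhere. The origin is the midpoint of \<open>x\<close> and \<open>-x\<close> and the value there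
  is zero, so the two nonpositive values at \<open>x\<close> and \<open>-x\<close> have a nonnegative sum; hence
  both are zero. Thus a convex function that vanishes on the axes is identically zero (lemma
  \<open>convex_vanishing_on_axes_eq_0\<close>), and a nonzero polynomial of this form is not convex. This
  avoids the Hessian altogether.\<close>

lemma convex_on_midpoint_le:
  fixes f :: "'a::real_vector \<Rightarrow> real"
  assumes "convex_on UNIV f"
  shows "f ((1/2) *\<^sub>R x + (1/2) *\<^sub>R y) \<le> (f x + f y) / 2"
  using convex_onD[OF assms, of "1/2" x y] by simp

lemma convex_vanishing_on_axes_eq_0:
  fixes f :: "real ^ 2 \<Rightarrow> real"
  assumes convex: "convex_on UNIV f"
    and axes: "\<And>x. x $ 1 = 0 \<or> x $ 2 = 0 \<Longrightarrow> f x = 0"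
  shows "f x = 0"
proof -
  have nonpos: "f y \<le> 0" for y
  proof -
    define u v :: "real ^ 2" where "u = vector [2 * y $ 1, 0]" and "v = vector [0, 2 * y $ 2]"
    have "(1/2) *\<^sub>R u + (1/2) *\<^sub>R v = y"
      by (simp add: vec_eq_iff forall_2 u_def v_def)
    moreover have "f u = 0" "f v = 0"
      by (simp_all add: axes u_def v_def)
    ultimately show ?thesis
      using convex_on_midpoint_le[OF convex, of u v] by simp
  qed
  have "0 \<le> f x + f (- x)"
    using convex_on_midpoint_le[OF convex, of x "- x"] axes[of 0] by simp
  with nonpos[of x] nonpos[of "- x"] show ?thesis
    by linarith
qed

theorem theorem3p1:
  fixes l1 l2 c :: real and \<alpha>1 \<alpha>2 \<beta>1 \<beta>2 :: nat
  assumes "l1 \<ge> 0" and "l2 \<ge> 0"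
    and "\<alpha>1 \<ge> 2" and "even \<alpha>1" and "\<alpha>2 \<ge> 2" and "even \<alpha>2"
    and "\<beta>1 \<ge> 2" and "even \<beta>1" and "\<beta>2 \<ge> 2" and "even \<beta>2"
    and nonzero: "ahi2 l1 l2 c \<alpha>1 \<alpha>2 \<beta>1 \<beta>2 \<noteq> (\<lambda>x. 0)"
  shows "\<not> convex_on (UNIV :: (real ^ 2) set) (ahi2 l1 l2 c \<alpha>1 \<alpha>2 \<beta>1 \<beta>2)"
proof
  assume convex: "convex_on (UNIV :: (real ^ 2) set) (ahi2 l1 l2 c \<alpha>1 \<alpha>2 \<beta>1 \<beta>2)"
  have "ahi2 l1 l2 c \<alpha>1 \<alpha>2 \<beta>1 \<beta>2 x = 0" if "x $ 1 = 0 \<or> x $ 2 = 0" for x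
    using that assms(3,5,7,9) by (auto simp: ahi2_def power_0_left)
  from convex_vanishing_on_axes_eq_0[OF convex this] nonzero show False
    by blast
qed

end
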